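(* Let $q$ be a prime power and consider the affine space $\mathrm{AG}(3,q)$. \begin{itemize} \item The only Cameron-Liebler line class of parameter $x=0$ in $\mathrm{AG}(3,q)$ is the empty set. \item The only Cameron-Liebler line classes of parameter $x=1$ in $\mathrm{AG}(3,q)$ are the point-pencils defined by an affine point: a set of lines of $\mathrm{AG}(3,q)$ is a Cameron-Liebler line class of parameter $1$ if and only if it is the set of all lines through some point of $\mathrm{AG}(3,q)$. \item There are no Cameron-Liebler line classes of parameter $x=2$ in $\mathrm{AG}(3,q)$. \end{itemize}
   Context: $\mathrm{AG}(3,q)$ is the 3-dimensional affine space over $\mathbb{F}_q$. A line spread of $\mathrm{AG}(3,q)$ is a set of pairwise disjoint lines of $\mathrm{AG}(3,q)$ that partitions the points of $\mathrm{AG}(3,q)$. A Cameron-Liebler line class of parameter $x$ in $\mathrm{AG}(3,q)$ is a set $\mathcal{L}$ of lines of $\mathrm{AG}(3,q)$ such that $|\mathcal{L}\cap\mathcal{S}|=x$ for every line spread $\mathcal{S}$ of $\mathrm{AG}(3,q)$. *)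

theory Defs
  imports "HOL-Analysis.Cartesian_Space" "HOL-Library.Disjoint_Sets"
    "HOL-Number_Theory.Prime_Powers"
begin

text \<open>
  The points of AG(3,q) are the vectors of type \<open>'a ^ 3\<close> over a field \<open>'a\<close> with \<open>q\<close> elements,
  and a line is identified with the set of its points.
\<close>

definition ag_line :: "('a::field ^ 3) set \<Rightarrow> bool" where
  "ag_line l \<longleftrightarrow> (\<exists>p v. v \<noteq> 0 \<and> l = {p + t *s v | t. True})"

definition line_spread :: "('a::field ^ 3) set set \<Rightarrow> bool" where
  "line_spread S \<longleftrightarrow> (\<forall>l\<in>S. ag_line l) \<and> partition_on UNIV S"

definition cameron_liebler :: "nat \<Rightarrow> ('a::{field,finite} ^ 3) set set \<Rightarrow> bool" where
  "cameron_liebler x L \<longleftrightarrow>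
     (\<forall>l\<in>L. ag_line l) \<and> (\<forall>S. line_spread S \<longrightarrow> card (L \<inter> S) = x)"

definition point_pencil :: "'a::field ^ 3 \<Rightarrow> ('a ^ 3) set set" where
  "point_pencil p = {l. ag_line l \<and> p \<in> l}"

end

theory Submission
  imports Defs
begin

text \<open>
  Parallel classes of lines are spreads, so a Cameron-Liebler class of parameter \<open>x\<close> contains
  exactly \<open>x\<close> lines of every direction. Turning the lines of a parallel class that lie in a fixed
  plane into another direction of that plane gives another spread; hence the number of lines of the
  class in a plane with a given direction does not depend on the direction chosen in the plane.

  If \<open>x = 1\<close>, this makes any two lines of the class coplanar, so they all meet pairwise, and as
  all directions occur they share a point. If \<open>x = 2\<close>, the plane spanned by the two lines of a
  direction contains both lines of each of its directions. Two planes that arise in this way share a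
  direction and therefore coincide, which is impossible since every direction occurs in one of them.
\<close>

section \<open>Cosets of subspaces and parallel classes\<close>

definition flat :: "'a::field ^ 'n \<Rightarrow> ('a ^ 'n) set \<Rightarrow> ('a ^ 'n) set" where
  "flat p W = {r. r - p \<in> W}"

text \<open>For \<open>v = 0\<close> the members are singletons rather than lines, whence the
  condition \<open>v \<noteq> 0\<close> wherever lines are meant.\<close>

definition parallel_class :: "'a::field ^ 'n \<Rightarrow> ('a ^ 'n) set set" where
  "parallel_class v = range (\<lambda>p. flat p (vec.span {v}))"

lemma mem_flat [simp]: "r \<in> flat p W \<longleftrightarrow> r - p \<in> W"
  by (simp add: flat_def)

lemma flat_eq:
  assumes "vec.subspace W" and "r \<in> flat p W"
  shows "flat r W = flat p W"
proof (intro set_eqI iffI)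
  fix s
  show "s \<in> flat p W" if "s \<in> flat r W"
    using vec.subspace_add[OF assms(1), of "s - r" "r - p"] that assms(2) by simp
  show "s \<in> flat r W" if "s \<in> flat p W"
    using vec.subspace_diff[OF assms(1), of "s - p" "r - p"] that assms(2) by simp
qed

lemma flat_mono_iff:
  assumes "vec.subspace V" and "vec.subspace W" and "V \<subseteq> W"
  shows "flat r V \<subseteq> flat p W \<longleftrightarrow> r \<in> flat p W"
proof
  show "r \<in> flat p W" if "flat r V \<subseteq> flat p W"
    using that vec.subspace_0[OF assms(1)] by (intro subsetD[OF that]) simp
  show "flat r V \<subseteq> flat p W" if "r \<in> flat p W"
    unfolding flat_eq[OF assms(2) that, symmetric] using assms(3) by auto
qed

lemma parallel_class_memD:
  assumes "l \<in> parallel_class v" and "r \<in> l"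
  shows "l = flat r (vec.span {v})"
  using assms flat_eq[OF vec.subspace_span] unfolding parallel_class_def by blast

lemma flat_in_parallel_class [simp]: "flat p (vec.span {v}) \<in> parallel_class v"
  by (simp add: parallel_class_def)

lemma mem_flat_self [simp]: "p \<in> flat p (vec.span A)"
  by (simp add: vec.span_zero)

lemma parallel_class_nonempty: "l \<in> parallel_class v \<Longrightarrow> \<exists>p. p \<in> l"
  unfolding parallel_class_def using mem_flat_self by blast

text \<open>Since \<open>v\<close> lies in \<open>W\<close>, every coset of \<open>W\<close> is a
  union of lines of direction \<open>v\<close>, so a single point of the line decides.\<close>

lemma parallel_class_subset_iff:
  assumes "l \<in> parallel_class v" and "r \<in> l" and "vec.subspace W" and "v \<in> W"
  shows "l \<subseteq> flat p W \<longleftrightarrow> r \<in> flat p W"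
  unfolding parallel_class_memD[OF assms(1,2)]
  by (rule flat_mono_iff) (use assms in \<open>auto simp: vec.span_minimal\<close>)

lemma ag_line_iff: "ag_line l \<longleftrightarrow> (\<exists>v. v \<noteq> 0 \<and> l \<in> parallel_class v)"
proof -
  have "{p + t *s v | t. True} = flat p (vec.span {v})" for p v :: "'a::field ^ 3"
    by (auto simp: vec.span_singleton algebra_simps image_iff)
  then show ?thesis
    unfolding ag_line_def parallel_class_def by auto
qed

section \<open>Spreads obtained by turning lines inside a flat\<close>

lemma partition_onI_unique:
  assumes "\<And>p. \<exists>!l. l \<in> S \<and> p \<in> l" and "{} \<notin> S"
  shows "partition_on UNIV S"
proof (rule partition_onI)
  show "disjnt l m" if "l \<in> S" "m \<in> S" "l \<noteq> m" for l m
    using assms(1) that unfolding disjnt_iff by metis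
  show "\<Union> S = UNIV"
    using assms(1) by blast
qed (use assms(2) in blast)

text \<open>A flat with direction space \<open>W\<close> and its complement are both unions of lines
  of direction \<open>v\<close>, and the flat is also a union of lines of direction
  \<open>u\<close>; so the lines inside can be exchanged without disturbing those outside.\<close>

lemma line_spread_switch:
  fixes u v p :: "'a::field ^ 3"
  assumes "u \<noteq> 0" and "v \<noteq> 0" and W: "vec.subspace W" "u \<in> W" "v \<in> W"
  shows "line_spread ({l \<in> parallel_class v. \<not> l \<subseteq> flat p W} \<union>
    {l \<in> parallel_class u. l \<subseteq> flat p W})" (is "line_spread ?S")
proof -
  have "\<exists>!l. l \<in> ?S \<and> r \<in> l" for r
  proof
    \<comment> \<open>The position of \<open>r\<close> relative to the flat dictates the direction
      of its block.\<close>
    let ?l = "flat r (vec.span {if r \<in> flat p W then u else v})"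
    have "?l \<subseteq> flat p W \<longleftrightarrow> r \<in> flat p W"
      by (rule parallel_class_subset_iff[where v = "if r \<in> flat p W then u else v"])
        (use W in \<open>simp_all add: vec.span_zero\<close>)
    then show "?l \<in> ?S \<and> r \<in> ?l"
      by (simp add: vec.span_zero)
    show "m = ?l" if "m \<in> ?S \<and> r \<in> m" for m
      using that parallel_class_memD[of m _ r] parallel_class_subset_iff[of m _ r W p] W
      by (auto simp del: mem_flat)
  qed
  moreover have "{} \<notin> ?S"
    using parallel_class_nonempty by blast
  ultimately have "partition_on UNIV ?S"
    by (rule partition_onI_unique)
  moreover have "ag_line l" if "l \<in> ?S" for l
    using that assms(1,2) unfolding ag_line_iff by blast
  ultimately show ?thesis
    unfolding line_spread_def by simp
qed

lemma line_spread_parallel_class: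
  fixes v :: "'a::field ^ 3"
  assumes "v \<noteq> 0"
  shows "line_spread (parallel_class v)"
proof -
  \<comment> \<open>Degenerate switch: the flat is the whole space and the direction is
    kept.\<close>
  have "{l \<in> parallel_class v. \<not> l \<subseteq> flat 0 UNIV} \<union> {l \<in> parallel_class v. l \<subseteq> flat 0 UNIV} =
    parallel_class v"
    by auto
  with line_spread_switch[of v v UNIV 0] assms show ?thesis
    by (simp add: vec.subspace_UNIV)
qed

section \<open>Counting the lines of a class by direction\<close>

context
  fixes L :: "('a::{field,finite} ^ 3) set set" and x :: nat
  assumes cl: "cameron_liebler x L"
begin

lemma card_direction: "v \<noteq> 0 \<Longrightarrow> card (L \<inter> parallel_class v) = x"
  using cl line_spread_parallel_class unfolding cameron_liebler_def by blast

text \<open>Switching the flat to \<open>u\<close> or leaving it at \<open>v\<close> gives two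
  spreads that share the outside lines \<open>?N\<close>; both inside counts are therefore
  \<open>x\<close> minus the size of \<open>?N\<close>.\<close>

lemma card_in_flat:
  assumes "u \<noteq> 0" and "v \<noteq> 0" and W: "vec.subspace W" "u \<in> W" "v \<in> W"
  shows "card {l \<in> L \<inter> parallel_class u. l \<subseteq> flat p W} =
    card {l \<in> L \<inter> parallel_class v. l \<subseteq> flat p W}"
proof -
  let ?N = "{l \<in> L \<inter> parallel_class v. \<not> l \<subseteq> flat p W}"
  have *: "card ?N + card {l \<in> L \<inter> parallel_class w. l \<subseteq> flat p W} = x"
    if "w \<noteq> 0" "w \<in> W" for w
  proof -
    have "card (L \<inter> ({l \<in> parallel_class v. \<not> l \<subseteq> flat p W} \<union>
      {l \<in> parallel_class w. l \<subseteq> flat p W})) = x"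
      using cl line_spread_switch that assms unfolding cameron_liebler_def by blast
    also have "L \<inter> ({l \<in> parallel_class v. \<not> l \<subseteq> flat p W} \<union>
      {l \<in> parallel_class w. l \<subseteq> flat p W}) = ?N \<union> {l \<in> L \<inter> parallel_class w. l \<subseteq> flat p W}"
      by blast
    finally show ?thesis
      by (subst card_Un_disjoint[symmetric]) (simp_all, blast)
  qed
  from *[of u] *[of v] assms show ?thesis
    by simp
qed

text \<open>Both directions have \<open>x\<close> lines in \<open>L\<close>, and the flat holds
  equally many of each. If it holds all of one direction, it holds all of the other.\<close>

lemma all_lines_in_flat:
  assumes "u \<noteq> 0" and "v \<noteq> 0" and "vec.subspace W" "u \<in> W" "v \<in> W"
    and sub: "\<And>l. l \<in> L \<inter> parallel_class u \<Longrightarrow> l \<subseteq> flat p W"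
    and l: "l \<in> L \<inter> parallel_class v"
  shows "l \<subseteq> flat p W"
proof -
  have "{l \<in> L \<inter> parallel_class u. l \<subseteq> flat p W} = L \<inter> parallel_class u"
    using sub by blast
  then have "card {l \<in> L \<inter> parallel_class v. l \<subseteq> flat p W} = card (L \<inter> parallel_class v)"
    using card_in_flat[of u v W p] card_direction[of u] card_direction[of v] assms by simp
  then have "{l \<in> L \<inter> parallel_class v. l \<subseteq> flat p W} = L \<inter> parallel_class v"
    by (intro card_subset_eq) auto
  with l show ?thesis
    by blast
qed

end

lemma cameron_liebler_0_iff:
  fixes L :: "('a::{field,finite} ^ 3) set set"
  shows "cameron_liebler 0 L \<longleftrightarrow> L = {}"
proof
  assume cl: "cameron_liebler 0 L"
  show "L = {}"
  proof (rule equals0I)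
    fix l assume l: "l \<in> L"
    then obtain v where "v \<noteq> 0" "l \<in> parallel_class v"
      using cl unfolding cameron_liebler_def ag_line_iff by blast
    with card_direction[OF cl] l show False
      by auto
  qed
qed (simp add: cameron_liebler_def)

text \<open>Exactly one block of a partition contains \<open>p\<close>.\<close>

lemma cameron_liebler_point_pencil:
  fixes p :: "'a::{field,finite} ^ 3"
  shows "cameron_liebler 1 (point_pencil p)"
  unfolding cameron_liebler_def
proof (intro conjI allI impI)
  fix S :: "('a ^ 3) set set" assume S: "line_spread S"
  then obtain l where l: "l \<in> S" "p \<in> l"
    unfolding line_spread_def partition_on_def by blast
  then have "point_pencil p \<inter> S = {l}"
    using S unfolding line_spread_def partition_on_def disjoint_def point_pencil_def by blast
  then show "card (point_pencil p \<inter> S) = 1"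
    by simp
qed (simp add: point_pencil_def)

section \<open>Linear algebra in three dimensions\<close>

lemma exists_not_in_subspace:
  fixes W :: "('a::field ^ 3) set"
  assumes "vec.dim W \<le> 2"
  shows "\<exists>z. z \<notin> W"
proof (rule ccontr)
  assume "\<nexists>z. z \<notin> W"
  then have "W = UNIV"
    by blast
  with assms show False
    by (simp add: card_cart_basis)
qed

lemma dim_span_pair:
  fixes u v :: "'a::field ^ 'n"
  assumes "u \<noteq> 0" and "v \<notin> vec.span {u}"
  shows "vec.dim (vec.span {u, v}) = 2"
proof -
  have "vec.independent {v, u}"
    using assms by (intro vec.independent_insertI) (auto simp: vec.independent_empty)
  moreover have "v \<noteq> u"
    using assms(2) vec.span_base by blast
  ultimately show ?thesis
    using vec.dim_span_eq_card_independent[of "{v, u}"] by (simp add: insert_commute)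
qed

lemma in_span_pairE:
  fixes u v :: "'a::field ^ 'n"
  assumes "w \<in> vec.span {u, v}"
  obtains a b where "w = a *s u + b *s v"
proof -
  obtain a where "w - a *s u \<in> vec.span {v}"
    using assms vec.span_breakdown_eq[of w u "{v}"] by blast
  then obtain b where "w - a *s u = b *s v"
    by (auto simp: vec.span_singleton)
  with that show thesis
    by (metis add.commute diff_add_cancel)
qed

lemma scale_in_span_imp:
  fixes v :: "'a::field ^ 'n"
  assumes "a *s v \<in> vec.span A" and "v \<notin> vec.span A"
  shows "a = 0"
  using assms vec.span_scale[of "a *s v" A "inverse a"] by (cases "a = 0") auto

section \<open>Parameter 1: concurrence of the lines\<close>

lemma cameron_liebler_1_imp:
  fixes L :: "('a::{field,finite} ^ 3) set set"
  assumes cl: "cameron_liebler 1 L"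
  shows "\<exists>p. L = point_pencil p"
proof -
  have "\<exists>l. L \<inter> parallel_class v = {l}" if "v \<noteq> 0" for v
    using card_direction[OF cl that] by (simp add: card_1_singleton_iff)
  then obtain line where line: "L \<inter> parallel_class v = {line v}" if "v \<noteq> 0" for v
    by metis
  have in_class: "line v \<in> parallel_class v" if "v \<noteq> 0" for v
    using line[OF that] by blast
  have eq_flat: "line v = flat r (vec.span {v})" if "v \<noteq> 0" "r \<in> line v" for v r
    by (rule parallel_class_memD[OF in_class[OF that(1)] that(2)])
  \<comment> \<open>The flat through \<open>line u\<close> with directions \<open>u\<close> and
    \<open>v\<close> contains the only line of \<open>L\<close> of direction \<open>u\<close>, hence
    also \<open>line v\<close>.\<close>
  have meet: "\<exists>r. r \<in> line u \<and> r \<in> line v" if uv: "u \<noteq> 0" "v \<noteq> 0" for u v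
  proof -
    obtain r s where rs: "r \<in> line u" "s \<in> line v"
      using parallel_class_nonempty[OF in_class] uv by metis
    have "line v \<subseteq> flat r (vec.span {u, v})"
    proof (rule all_lines_in_flat[OF cl uv])
      show "l \<subseteq> flat r (vec.span {u, v})" if "l \<in> L \<inter> parallel_class u" for l
      proof -
        have "l = line u"
          using that line[OF uv(1)] by blast
        then show ?thesis
          using parallel_class_subset_iff[of l u r "vec.span {u, v}" r] in_class[OF uv(1)] rs
          by (simp add: vec.span_base vec.span_zero)
      qed
    qed (use line uv in \<open>auto simp: vec.span_base\<close>)
    with rs have "s - r \<in> vec.span {u, v}"
      by auto
    \<comment> \<open>The common point is \<open>r + a *s u\<close>, which equals
      \<open>s - b *s v\<close>.\<close>
    then obtain a b where ab: "s - r = a *s u + b *s v"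
      by (rule in_span_pairE)
    then have "(r + a *s u) - s = (- b) *s v"
      by (simp add: algebra_simps)
    then have "r + a *s u \<in> line v"
      unfolding eq_flat[OF uv(2) rs(2)] by (simp add: vec.span_scale vec.span_base vec.span_neg)
    moreover have "r + a *s u \<in> line u"
      unfolding eq_flat[OF uv(1) rs(1)] by (simp add: vec.span_scale vec.span_base)
    ultimately show ?thesis
      by blast
  qed
  \<comment> \<open>Three pairwise meeting lines may form a triangle, but only in a plane. For
    independent directions, distinct points \<open>r\<close> and \<open>s\<close> of
    \<open>line w\<close> would put \<open>w\<close> into the span of \<open>u\<close> and
    \<open>v\<close>; so \<open>r = s\<close>, and this point of both \<open>line u\<close> and
    \<open>line v\<close> can only be \<open>p\<close>.\<close>
  have through: "p \<in> line w"
    if indep: "u \<noteq> 0" "v \<notin> vec.span {u}" "w \<notin> vec.span {u, v}"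
      and p: "p \<in> line u" "p \<in> line v" for p u v w
  proof -
    have "v \<noteq> 0" "w \<noteq> 0"
      using indep(2,3) vec.span_zero by blast+
    obtain r s where rs: "r \<in> line u" "r \<in> line w" "s \<in> line v" "s \<in> line w"
      using meet \<open>u \<noteq> 0\<close> \<open>v \<noteq> 0\<close> \<open>w \<noteq> 0\<close> by metis
    obtain a where a: "r - p = a *s u"
      using rs(1) eq_flat[OF \<open>u \<noteq> 0\<close> p(1)] by (auto simp: vec.span_singleton)
    obtain b where b: "s - p = b *s v"
      using rs(3) eq_flat[OF \<open>v \<noteq> 0\<close> p(2)] by (auto simp: vec.span_singleton)
    obtain c where c: "s - r = c *s w"
      using rs(4) eq_flat[OF \<open>w \<noteq> 0\<close> rs(2)] by (auto simp: vec.span_singleton)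
    have "c *s w = b *s v - a *s u"
      using a b c by (simp add: algebra_simps flip: a b c)
    moreover have "b *s v - a *s u \<in> vec.span {u, v}"
      by (intro vec.span_diff vec.span_scale vec.span_base) auto
    ultimately have "c = 0"
      using scale_in_span_imp indep(3) by metis
    then have "b *s v = a *s u"
      using \<open>c *s w = b *s v - a *s u\<close> by simp
    then have "b *s v \<in> vec.span {u}"
      by (simp add: vec.span_scale vec.span_base)
    then have "b = 0"
      using scale_in_span_imp indep(2) by metis
    with b rs(4) show ?thesis
      by simp
  qed
  obtain u :: "'a ^ 3" where u: "u \<noteq> 0"
    using exists_not_in_subspace[of "{0}"] by auto
  obtain v where v: "v \<notin> vec.span {u}"
    using exists_not_in_subspace[of "vec.span {u}"] u by (auto simp: vec.dim_singleton)
  obtain z where z: "z \<notin> vec.span {u, v}"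
    using exists_not_in_subspace dim_span_pair[OF u v] by (metis order_refl)
  have "v \<noteq> 0" and "z \<noteq> 0"
    using v z vec.span_zero by blast+
  then obtain p where p: "p \<in> line u" "p \<in> line v"
    using meet u by blast
  have pz: "p \<in> line z"
    using through[OF u v z p] .
  \<comment> \<open>The basis \<open>u\<close>, \<open>v\<close>, \<open>z\<close> lets every
    \<open>w\<close> not parallel to \<open>u\<close> complete an independent triple containing
    \<open>u\<close> and one of \<open>v\<close>, \<open>z\<close>.\<close>
  have all: "p \<in> line w" if "w \<noteq> 0" for w
  proof (cases "w \<in> vec.span {u}")
    case True
    then obtain a where a: "w = a *s u"
      by (auto simp: vec.span_singleton)
    then have "vec.span {w} = vec.span {u}"
      using vec.span_image_scale[of "{u}" "\<lambda>_. a"] that by auto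
    then have "line w = line u"
      using line[OF that] line[OF u] unfolding parallel_class_def by auto
    with p show ?thesis
      by simp
  next
    case False
    show ?thesis
    proof (cases "w \<in> vec.span {u, v}")
      case True
      \<comment> \<open>Here \<open>w\<close> depends on \<open>u\<close> and \<open>v\<close>, so
        \<open>z\<close> takes the place of \<open>v\<close>; by exchange, \<open>w\<close> in the
        span of \<open>u\<close> and \<open>z\<close> would put \<open>z\<close> into the span of
        \<open>u\<close> and \<open>v\<close>.\<close>
      have "z \<notin> vec.span {u}"
        using z vec.span_mono[of "{u}" "{u, v}"] by auto
      moreover have "w \<notin> vec.span {u, z}"
      proof
        assume "w \<in> vec.span {u, z}"
        then have "z \<in> vec.span {u, w}"
          using vec.in_span_insert[of w z "{u}"] False by (simp add: insert_commute)
        moreover have "vec.span {u, w} \<subseteq> vec.span {u, v}"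
          using True by (intro vec.span_minimal) (auto simp: vec.span_base)
        ultimately show False
          using z by blast
      qed
      ultimately show ?thesis
        using through[OF u _ _ p(1) pz] by blast
    next
      case False
      then show ?thesis
        using through[OF u v _ p] by blast
    qed
  qed
  have "L = point_pencil p"
  proof (intro set_eqI iffI)
    fix l assume l: "l \<in> L"
    then obtain w where "w \<noteq> 0" "l \<in> parallel_class w"
      using cl unfolding cameron_liebler_def ag_line_iff by blast
    then show "l \<in> point_pencil p"
      using all line[of w] l unfolding point_pencil_def ag_line_iff by blast
  next
    fix l assume "l \<in> point_pencil p"
    then obtain w where w: "w \<noteq> 0" "l \<in> parallel_class w" "p \<in> l"
      unfolding point_pencil_def ag_line_iff by blast
    then have "l = line w"
      using parallel_class_memD eq_flat all by metis
    with line[OF w(1)] show "l \<in> L"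
      by blast
  qed
  then show ?thesis ..
qed

section \<open>Parameter 2: two planes that must coincide\<close>

lemma not_cameron_liebler_2:
  fixes L :: "('a::{field,finite} ^ 3) set set"
  shows "\<not> cameron_liebler 2 L"
proof
  assume cl: "cameron_liebler 2 L"
  have two: "\<exists>r s. s - r \<notin> vec.span {v} \<and>
    L \<inter> parallel_class v = {flat r (vec.span {v}), flat s (vec.span {v})}" if v: "v \<noteq> 0" for v
  proof -
    obtain l m where lm: "L \<inter> parallel_class v = {l, m}" "l \<noteq> m"
      using card_direction[OF cl v] by (auto simp: card_2_iff)
    then have "l \<in> parallel_class v" "m \<in> parallel_class v"
      by blast+
    then obtain r s where rs: "l = flat r (vec.span {v})" "m = flat s (vec.span {v})"
      unfolding parallel_class_def by (elim rangeE)
    then have "s - r \<notin> vec.span {v}"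
      using lm(2) flat_eq[of "vec.span {v}" s r] by auto
    with lm(1) show ?thesis
      unfolding rs by (intro exI conjI)
  qed
  have plane: "\<exists>p W. vec.subspace W \<and> vec.dim W = 2 \<and> v \<in> W \<and>
    (\<forall>u\<in>W - {0}. \<forall>l \<in> L \<inter> parallel_class u. l \<subseteq> flat p W)" if v: "v \<noteq> 0" for v
  proof -
    obtain r s where rs: "s - r \<notin> vec.span {v}"
      "L \<inter> parallel_class v = {flat r (vec.span {v}), flat s (vec.span {v})}"
      using two[OF v] by blast
    \<comment> \<open>This is the direction space of the plane through the two parallel lines; the
      plane itself is \<open>flat r W\<close>.\<close>
    define W where "W = vec.span {v, s - r}"
    have W: "vec.subspace W" "vec.dim W = 2" "v \<in> W" "s - r \<in> W"
      using dim_span_pair[OF v rs(1)] by (auto simp: W_def vec.span_base)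
    have "flat t (vec.span {v}) \<subseteq> flat r W" if "t - r \<in> W" for t
      using that parallel_class_subset_iff[of "flat t (vec.span {v})" v t W r] W
      by (simp add: vec.span_zero)
    from this[of r] this[of s] have "l \<subseteq> flat r W" if "l \<in> L \<inter> parallel_class v" for l
      using that W(1,4) unfolding rs(2) by (elim insertE) (simp_all add: vec.subspace_0)
    then have "\<forall>u\<in>W - {0}. \<forall>l \<in> L \<inter> parallel_class u. l \<subseteq> flat r W"
      using all_lines_in_flat[OF cl v _ W(1,3)] by blast
    with W show ?thesis
      by blast
  qed
  obtain v :: "'a ^ 3" where "v \<noteq> 0"
    using exists_not_in_subspace[of "{0}"] by auto
  then obtain p W where W: "vec.subspace W" "vec.dim W = 2"
    "\<And>u l. u \<in> W \<Longrightarrow> u \<noteq> 0 \<Longrightarrow> l \<in> L \<inter> parallel_class u \<Longrightarrow> l \<subseteq> flat p W"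
    using plane[of v] by blast
  \<comment> \<open>A direction outside the first plane produces a second one with \<open>W'\<close>
    different from \<open>W\<close>.\<close>
  obtain w where w: "w \<notin> W"
    using exists_not_in_subspace[of W] W(2) by auto
  then have "w \<noteq> 0"
    using vec.subspace_0[OF W(1)] by blast
  then obtain p' W' where W': "vec.subspace W'" "vec.dim W' = 2" "w \<in> W'"
    "\<And>u l. u \<in> W' \<Longrightarrow> u \<noteq> 0 \<Longrightarrow> l \<in> L \<inter> parallel_class u \<Longrightarrow> l \<subseteq> flat p' W'"
    using plane[of w] by blast
  \<comment> \<open>The sum has dimension at most 3, so a nonzero common direction \<open>e\<close>
    is left.\<close>
  have "vec.dim {a + b |a b. a \<in> W \<and> b \<in> W'} + vec.dim (W \<inter> W') = 4"
    using vec.dim_sums_Int[OF W(1) W'(1)] W(2) W'(2) by simp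
  moreover have "vec.dim {a + b |a b. a \<in> W \<and> b \<in> W'} \<le> 3"
    using dim_subset_UNIV_cart_gen[of "{a + b |a b. a \<in> W \<and> b \<in> W'}"] by simp
  ultimately have "vec.dim (W \<inter> W') \<noteq> 0"
    by linarith
  then obtain e where e: "e \<in> W" "e \<in> W'" "e \<noteq> 0"
    by (auto simp: vec.dim_eq_0)
  obtain r s where rs: "s - r \<notin> vec.span {e}"
    "L \<inter> parallel_class e = {flat r (vec.span {e}), flat s (vec.span {e})}"
    using two[OF e(3)] by blast
  \<comment> \<open>A flat containing both lines of direction \<open>e\<close> also has the
    direction joining them. Applied to both planes, this gives \<open>W\<close> and
    \<open>W'\<close> a second common direction independent of \<open>e\<close>, so both are the
    span of the two.\<close>
  have "s - r \<in> U" if "vec.subspace U"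
    and sub: "\<And>l. l \<in> L \<inter> parallel_class e \<Longrightarrow> l \<subseteq> flat t U" for t U
  proof -
    have "r \<in> flat t U" "s \<in> flat t U"
      using sub[unfolded rs(2)] mem_flat_self[of _ "{e}"] by blast+
    then show ?thesis
      using vec.subspace_diff[OF that(1), of "s - t" "r - t"] by simp
  qed
  from this[OF W(1) W(3)[OF e(1,3)]] this[OF W'(1) W'(4)[OF e(2,3)]]
  have "s - r \<in> W \<inter> W'"
    by simp
  then have "vec.span {e, s - r} \<subseteq> W \<inter> W'"
    using e W(1) W'(1) by (intro vec.span_minimal vec.subspace_inter) auto
  moreover have "vec.dim (vec.span {e, s - r}) = 2"
    by (rule dim_span_pair[OF e(3) rs(1)])
  ultimately have "vec.span {e, s - r} = W" "vec.span {e, s - r} = W'"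
    using W W' by (intro vec.subspace_dim_equal; simp)+
  with w W'(3) show False
    by blast
qed

theorem corollary4p5:
  fixes q :: nat
  assumes "primepow q" and "CARD('a::{field,finite}) = q"
  shows "(\<forall>L :: ('a ^ 3) set set. cameron_liebler 0 L \<longleftrightarrow> L = {}) \<and>
    (\<forall>L :: ('a ^ 3) set set. cameron_liebler 1 L \<longleftrightarrow> (\<exists>p. L = point_pencil p)) \<and>
    \<not> (\<exists>L :: ('a ^ 3) set set. cameron_liebler 2 L)"
  by (intro conjI allI)
    (auto simp: cameron_liebler_0_iff not_cameron_liebler_2 dest: cameron_liebler_1_imp
      intro: cameron_liebler_point_pencil simp del: One_nat_def)

end
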